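(* Let $n_1\ge n_2$, $1\le k\le n_2$, $\rho>0$, and let $A\in\mathbb{R}^{n_1\times n_2}$ have singular value decomposition $A=H\Sigma W^T$, where $H\in\mathbb{R}^{n_1\times n_1}$ and $W\in\mathbb{R}^{n_2\times n_2}$ are orthogonal matrices and $\Sigma=\begin{pmatrix}\mathrm{Diag}(a)\\0\end{pmatrix}\in\mathbb{R}^{n_1\times n_2}$ with $a\in\mathbb{R}^{n_2}$, $a_1\ge\dots\ge a_{n_2}\ge0$. Let $w=(a_1,\dots,a_k)^T$ and $c=\sqrt{\sum_{i=k+1}^{n_2}a_i^2}$, and let $s^*\in\mathbb{R}^k$ be an optimal solution to $$\min_{s\in\mathbb{R}^k,\ s\ge0}\ \sqrt{\|s-w\|_2^2+c^2}+\rho\langle s,1_k\rangle.$$ Then $$(U^*,V^* )=\left(H\begin{pmatrix}\mathrm{Diag}(\sqrt{s^*})\\0_{(n_1-k)\times k}\end{pmatrix},\ W\begin{pmatrix}\mathrm{Diag}(\sqrt{s^*})\\0_{(n_2-k)\times k}\end{pmatrix}\right)$$ is an optimal solution to $$\min_{U\in\mathbb{R}^{n_1\times k},\,V\in\mathbb{R}^{n_2\times k}}\ \|UV^T-A\|_F+\frac{\rho}{2}\left(\|U\|_F^2+\|V\|_F^2\right),$$ where $\sqrt{s^*}:=(\sqrt{s_1^*},\dots,\sqrt{s_k^*})^T$.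
   Context: $\|\cdot\|_F$ is the Frobenius norm, $\mathrm{Diag}(v)$ the square diagonal matrix with diagonal $v$, $1_k\in\mathbb{R}^k$ the vector of all ones, and $0_{p\times q}$ the $p\times q$ zero matrix. *)

theory Defs
  imports "Jordan_Normal_Form.Matrix" "HOL-Analysis.L2_Norm"
begin

definition vec_norm2 :: "real vec \<Rightarrow> real" where
  "vec_norm2 v = L2_set (\<lambda>i. v $ i) {..<dim_vec v}"

definition frobenius_norm :: "real mat \<Rightarrow> real" where
  "frobenius_norm A = L2_set (\<lambda>(i, j). A $$ (i, j)) ({..<dim_row A} \<times> {..<dim_col A})"

definition Diag :: "real vec \<Rightarrow> real mat" where
  "Diag v = mat_diag (dim_vec v) (\<lambda>i. v $ i)"

text \<open>
  The library predicate \<^const>\<open>orthogonal_mat\<close> only asks for pairwise orthogonal nonzero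
  columns. Here orthogonality of a matrix has the usual meaning: a square matrix whose
  inverse is its transpose.
\<close>

definition orthogonal_matrix_of :: "nat \<Rightarrow> real mat \<Rightarrow> bool" where
  "orthogonal_matrix_of n Q \<longleftrightarrow>
    Q \<in> carrier_mat n n \<and> Q\<^sup>T * Q = 1\<^sub>m n \<and> Q * Q\<^sup>T = 1\<^sub>m n"

end

theory Submission
  imports Defs
begin

text \<open>
  The Frobenius norm is invariant under \<open>U \<mapsto> H U\<close>, \<open>V \<mapsto> W V\<close>, so the problem reduces to
  \<open>A = \<Sigma>\<close>. There the candidate pair attains the optimal value of the vector problem, by a direct
  computation, and what has to be shown is that no pair does better. Put
  \<open>r = \<parallel>U V\<^sup>T - \<Sigma>\<parallel>\<close> and \<open>N = (\<parallel>U\<parallel>\<^sup>2 + \<parallel>V\<parallel>\<^sup>2) / 2\<close>, so that the objective is \<open>r + \<rho> N\<close>.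

  For every \<open>\<tau> \<ge> 0\<close> the smooth penalized objective \<open>r\<^sup>2 + 2 \<tau> N\<close> is at least its value at the diagonal pair built
  from the soft threshold \<open>b\<^sub>i = max 0 (a\<^sub>i - \<tau>)\<close>, \<open>i < k\<close> (\<open>penalized_diagonal_bound\<close>). Indeed, replacing
  \<open>\<Sigma>\<close> by the diagonal matrix with entries \<open>b\<close> changes \<open>r\<^sup>2\<close> by a constant and by
  \<open>2 \<Sum>\<^sub>i (a\<^sub>i - b\<^sub>i) u\<^sub>i \<bullet> v\<^sub>i\<close>, where \<open>u\<^sub>i\<close> and \<open>v\<^sub>i\<close> are the rows of \<open>U\<close> and \<open>V\<close>;
  since \<open>0 \<le> a\<^sub>i - b\<^sub>i \<le> \<tau>\<close>, the penalty \<open>2 \<tau> N\<close> pays for this linear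
  term. What remains is the distance from a diagonal matrix to the matrices of rank at most \<open>k\<close>,
  which the Eckart--Young bound \<open>Eckart_Young_diagonal\<close> controls; that bound follows by projecting
  the coordinate axes onto the row space.

  The step from squared to plain norm is \<open>le_of_penalized_bounds\<close>. If \<open>R\<close> and \<open>S\<close> are the
  residual norm and the coordinate sum of the soft threshold for \<open>\<tau> = \<rho> r\<close>, then
  \<open>2 r (r + \<rho> N) = r\<^sup>2 + (r\<^sup>2 + 2 \<tau> N) \<ge> r\<^sup>2 + R\<^sup>2 + 2 \<tau> S \<ge> 2 r (R + \<rho> S)\<close>, and \<open>R + \<rho> S\<close> is a
  value of the vector problem. Dividing by \<open>2 r\<close> bounds \<open>r + \<rho> N\<close> below by the optimal value of
  that problem; for \<open>r = 0\<close> the same computation with \<open>r + \<epsilon>\<close> in place of \<open>r\<close> gives the bound in the limit.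
\<close>

section \<open>Projections onto the span of a finite family\<close>

text \<open>
  Gram--Schmidt in a form that never divides by the norm of a dependent vector: the matrix of the
  orthogonal projection is updated by \<open>r r\<^sup>T / \<parallel>r\<parallel>\<^sup>2\<close>, where \<open>r\<close> is the part of the next vector that is
  orthogonal to the earlier ones. Each update raises the trace by one, so the trace bounds the rank.
\<close>

lemma exists_projection:
  fixes v :: "nat \<Rightarrow> 'a \<Rightarrow> real"
  assumes fin: "finite I"
  shows "\<exists>P. (\<forall>i j. P i j = P j i) \<and> (\<forall>i j. (\<Sum>m\<in>I. P i m * P m j) = P i j)
    \<and> (\<forall>l<k. \<forall>i\<in>I. (\<Sum>m\<in>I. P i m * v l m) = v l i) \<and> (\<Sum>i\<in>I. P i i) \<le> real k"
proof (induction k)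
  case 0
  show ?case by (rule exI[of _ "\<lambda>i j. 0"]) simp
next
  case (Suc k)
  then obtain P where sym: "\<And>i j. P i j = P j i"
    and idem: "\<And>i j. (\<Sum>m\<in>I. P i m * P m j) = P i j"
    and fixP: "\<And>l i. l < k \<Longrightarrow> i \<in> I \<Longrightarrow> (\<Sum>m\<in>I. P i m * v l m) = v l i"
    and tr: "(\<Sum>i\<in>I. P i i) \<le> real k" by blast
  define r where "r i = v k i - (\<Sum>m\<in>I. P i m * v k m)" for i
  define N where "N = (\<Sum>i\<in>I. (r i)\<^sup>2)"
  have Pr: "(\<Sum>m\<in>I. P i m * r m) = 0" for i
  proof -
    have "(\<Sum>m\<in>I. P i m * (\<Sum>l\<in>I. P m l * v k l)) = (\<Sum>l\<in>I. (\<Sum>m\<in>I. P i m * P m l) * v k l)"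
      by (simp add: sum_distrib_left sum_distrib_right mult.assoc)
         (rule sum.swap)
    then show ?thesis
      by (simp add: r_def right_diff_distrib sum_subtractf idem)
  qed
  have rP: "(\<Sum>m\<in>I. r m * P m i) = 0" for i
  proof -
    have "(\<Sum>m\<in>I. r m * P m i) = (\<Sum>m\<in>I. P i m * r m)"
      by (intro sum.cong refl) (metis mult.commute sym)
    then show ?thesis by (simp add: Pr)
  qed
  show ?case
  proof (cases "N = 0")
    case True
    then have "\<forall>i\<in>I. r i = 0"
      unfolding N_def using fin by (simp add: sum_nonneg_eq_0_iff)
    then have "\<And>l i. l < Suc k \<Longrightarrow> i \<in> I \<Longrightarrow> (\<Sum>m\<in>I. P i m * v l m) = v l i"
      using fixP by (auto simp: r_def less_Suc_eq)
    then show ?thesis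
      by (intro exI[of _ P] conjI allI impI ballI sym idem) (use tr in simp_all)
  next
    case False
    define Q where "Q i j = P i j + r i * r j / N" for i j
    have rr: "(\<Sum>m\<in>I. r m * r m) = N"
      by (simp add: N_def power2_eq_square)
    have Qapp: "(\<Sum>m\<in>I. Q i m * x m) = (\<Sum>m\<in>I. P i m * x m) + r i * (\<Sum>m\<in>I. r m * x m) / N"
      for i x
      by (simp add: Q_def distrib_right sum.distrib sum_distrib_left sum_divide_distrib mult.assoc)
    have 1: "Q i j = Q j i" for i j
      by (simp add: Q_def sym[of i j])
    have rQ: "(\<Sum>m\<in>I. r m * Q m j) = r j" for j
    proof -
      have "(\<Sum>m\<in>I. r m * Q m j) = (\<Sum>m\<in>I. r m * P m j) + (\<Sum>m\<in>I. r m * r m) * r j / N"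
        by (simp add: Q_def distrib_left sum.distrib sum_distrib_right sum_divide_distrib mult.assoc)
      then show ?thesis using False by (simp add: rP rr)
    qed
    have PQ: "(\<Sum>m\<in>I. P i m * Q m j) = P i j" for i j
    proof -
      have "(\<Sum>m\<in>I. P i m * Q m j) = (\<Sum>m\<in>I. P i m * P m j) + (\<Sum>m\<in>I. P i m * r m) * r j / N"
        by (simp add: Q_def distrib_left sum.distrib sum_distrib_right sum_divide_distrib mult.assoc)
      then show ?thesis by (simp add: idem Pr)
    qed
    have 2: "(\<Sum>m\<in>I. Q i m * Q m j) = Q i j" for i j
      by (subst Qapp) (simp add: PQ rQ, simp add: Q_def)
    have rv_old: "(\<Sum>m\<in>I. r m * v l m) = 0" if "l < k" for l
    proof -
      have "(\<Sum>m\<in>I. r m * v l m) = (\<Sum>m\<in>I. r m * (\<Sum>i\<in>I. P m i * v l i))"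
        using fixP[OF that] by simp
      also have "\<dots> = (\<Sum>i\<in>I. (\<Sum>m\<in>I. r m * P m i) * v l i)"
        by (simp add: sum_distrib_left sum_distrib_right mult.assoc) (rule sum.swap)
      finally show ?thesis by (simp add: rP)
    qed
    have rv_new: "(\<Sum>m\<in>I. r m * v k m) = N"
    proof -
      have "(\<Sum>m\<in>I. r m * v k m) = (\<Sum>m\<in>I. r m * r m) + (\<Sum>m\<in>I. r m * (\<Sum>i\<in>I. P m i * v k i))"
        by (simp add: r_def sum.distrib[symmetric] algebra_simps)
      also have "(\<Sum>m\<in>I. r m * (\<Sum>i\<in>I. P m i * v k i)) = (\<Sum>i\<in>I. (\<Sum>m\<in>I. r m * P m i) * v k i)"
        by (simp add: sum_distrib_left sum_distrib_right mult.assoc) (rule sum.swap)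
      finally show ?thesis by (simp add: rP rr)
    qed
    have 3: "(\<Sum>m\<in>I. Q i m * v l m) = v l i" if "l < Suc k" "i \<in> I" for l i
    proof (cases "l = k")
      case True
      then show ?thesis using False by (simp add: Qapp rv_new) (simp add: r_def)
    next
      case l: False
      then show ?thesis using that by (simp add: Qapp rv_old fixP)
    qed
    have "(\<Sum>i\<in>I. Q i i) = (\<Sum>i\<in>I. P i i) + (\<Sum>i\<in>I. r i * r i) / N"
      by (simp add: Q_def sum.distrib sum_divide_distrib)
    then have 4: "(\<Sum>i\<in>I. Q i i) \<le> real (Suc k)"
      using tr False by (simp add: rr)
    show ?thesis using 1 2 3 4 by (intro exI[of _ Q]) blast
  qed
qed

text \<open>The diagonal entry of a projection is the squared norm of the corresponding row.\<close>

lemma projection_diagonal_bounds: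
  fixes P :: "'a \<Rightarrow> 'a \<Rightarrow> real"
  assumes fin: "finite I" and i: "i \<in> I" and sym: "\<And>i j. P i j = P j i"
    and idem: "\<And>i j. (\<Sum>m\<in>I. P i m * P m j) = P i j"
  shows "0 \<le> P i i" and "P i i \<le> 1"
proof -
  have eq: "P i i = (\<Sum>m\<in>I. (P i m)\<^sup>2)"
  proof -
    have "(\<Sum>m\<in>I. (P i m)\<^sup>2) = (\<Sum>m\<in>I. P i m * P m i)"
      by (intro sum.cong refl) (metis power2_eq_square sym)
    then show ?thesis by (simp add: idem)
  qed
  then show "0 \<le> P i i" by (simp add: sum_nonneg)
  have "(P i i)\<^sup>2 \<le> P i i"
    using member_le_sum[OF i, of "\<lambda>m. (P i m)\<^sup>2"] fin eq by simp
  then have "P i i * P i i \<le> 1 * P i i" by (simp add: power2_eq_square)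
  then show "P i i \<le> 1"
    using mult_strict_right_mono[of 1 "P i i" "P i i"] by linarith
qed

text \<open>
  The squared distance from \<open>b e\<^sub>i\<close> to the range of the projection \<open>P\<close> is \<open>b\<^sup>2 \<parallel>g\<parallel>\<^sup>2\<close> with
  \<open>g = e\<^sub>i - P e\<^sub>i\<close>, which is orthogonal to that range, and \<open>\<parallel>g\<parallel>\<^sup>2 = \<langle>e\<^sub>i, g\<rangle> = 1 - P\<^sub>i\<^sub>i\<close>.
\<close>

lemma dist_axis_ge_projection:
  fixes P :: "'a \<Rightarrow> 'a \<Rightarrow> real" and x :: "'a \<Rightarrow> real"
  assumes fin: "finite I" and i: "i \<in> I" and sym: "\<And>i j. P i j = P j i"
    and idem: "\<And>i j. (\<Sum>m\<in>I. P i m * P m j) = P i j"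
    and fixed: "\<And>i. i \<in> I \<Longrightarrow> (\<Sum>m\<in>I. P i m * x m) = x i"
  shows "b\<^sup>2 * (1 - P i i) \<le> (\<Sum>j\<in>I. (x j - (if i = j then b else 0))\<^sup>2)"
proof -
  define \<delta> where "\<delta> j = (if i = j then 1 else 0 :: real)" for j
  define g where "g j = \<delta> j - P i j" for j
  have sum_\<delta>: "(\<Sum>j\<in>I. \<delta> j * f j) = f i" for f
  proof -
    have "(\<Sum>j\<in>I. \<delta> j * f j) = (\<Sum>j\<in>I. if i = j then f j else 0)"
      by (rule sum.cong) (auto simp: \<delta>_def)
    then show ?thesis using fin i by simp
  qed
  have PP: "(\<Sum>j\<in>I. P i j * P i j) = P i i"
  proof -
    have "(\<Sum>j\<in>I. P i j * P i j) = (\<Sum>m\<in>I. P i m * P m i)"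
      by (intro sum.cong refl) (metis sym)
    then show ?thesis by (simp add: idem)
  qed
  have xg: "(\<Sum>j\<in>I. g j * x j) = 0"
    using sum_\<delta>[of x] fixed[OF i] by (simp add: g_def left_diff_distrib sum_subtractf)
  have gg: "(\<Sum>j\<in>I. g j * g j) = 1 - P i i"
  proof -
    have "(\<Sum>j\<in>I. g j * g j) = (\<Sum>j\<in>I. \<delta> j * \<delta> j - 2 * (\<delta> j * P i j) + P i j * P i j)"
      by (rule sum.cong) (auto simp: g_def algebra_simps)
    also have "\<dots> = \<delta> i - 2 * P i i + P i i"
      by (simp add: sum.distrib sum_subtractf sum_\<delta> PP flip: sum_distrib_left)
    finally show ?thesis by (simp add: \<delta>_def)
  qed
  have \<delta>g: "(\<Sum>j\<in>I. \<delta> j * g j) = 1 - P i i"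
    by (simp add: sum_\<delta>) (simp add: g_def \<delta>_def)
  \<comment> \<open>Since \<open>x\<close> is orthogonal to \<open>g\<close>, adding \<open>b g\<close> to the difference minimizes its norm over all
    multiples of \<open>g\<close>.\<close>
  have "0 \<le> (\<Sum>j\<in>I. ((x j - b * \<delta> j) + b * g j)\<^sup>2)"
    by (simp add: sum_nonneg)
  also have "\<dots> = (\<Sum>j\<in>I. (x j - b * \<delta> j)\<^sup>2 + 2 * b * (g j * x j)
      - 2 * b\<^sup>2 * (\<delta> j * g j) + b\<^sup>2 * (g j * g j))"
    by (rule sum.cong) (auto simp: power2_eq_square algebra_simps)
  also have "\<dots> = (\<Sum>j\<in>I. (x j - b * \<delta> j)\<^sup>2) - b\<^sup>2 * (1 - P i i)"
    by (simp add: sum.distrib sum_subtractf xg gg \<delta>g flip: sum_distrib_left)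
  also have "(\<Sum>j\<in>I. (x j - b * \<delta> j)\<^sup>2) = (\<Sum>j\<in>I. (x j - (if i = j then b else 0))\<^sup>2)"
    by (rule sum.cong) (auto simp: \<delta>_def)
  finally show ?thesis by simp
qed

section \<open>Low-rank approximation of a diagonal matrix\<close>

text \<open>
  Removing mass at most \<open>p\<^sub>i \<le> 1\<close> from each term, with total mass at most \<open>k\<close>, costs at most the
  \<open>k\<close> largest terms. The value \<open>d\<^sub>k\<close> separates the head from the tail, so mass moved from the tail
  to the head is exchanged at a favourable rate.
\<close>

lemma tail_le_weighted_sum:
  fixes d p :: "nat \<Rightarrow> real"
  assumes anti: "\<And>i j. i \<le> j \<Longrightarrow> j < n \<Longrightarrow> d j \<le> d i"
    and nonneg: "\<And>i. i < n \<Longrightarrow> 0 \<le> d i"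
    and p0: "\<And>i. i < n \<Longrightarrow> 0 \<le> p i" and p1: "\<And>i. i < n \<Longrightarrow> p i \<le> 1"
    and psum: "(\<Sum>i<n. p i) \<le> real k" and k: "k \<le> n"
  shows "(\<Sum>i=k..<n. d i) \<le> (\<Sum>i<n. d i * (1 - p i))"
proof (cases "k = n")
  case True
  have "0 \<le> (\<Sum>i<n. d i * (1 - p i))"
    by (intro sum_nonneg mult_nonneg_nonneg) (auto simp: nonneg p1)
  with True show ?thesis by simp
next
  case False
  then have kn: "k < n" using k by simp
  have split: "(\<Sum>i<n. f i) = (\<Sum>i<k. f i) + (\<Sum>i=k..<n. f i)" for f :: "nat \<Rightarrow> real"
    using sum.atLeastLessThan_concat[of 0 k n f] k by (simp add: atLeast0LessThan)
  have head: "(\<Sum>i<k. d k * (1 - p i)) \<le> (\<Sum>i<k. d i * (1 - p i))"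
    using kn by (intro sum_mono mult_right_mono anti) (auto simp: p1)
  have tail: "(\<Sum>i=k..<n. d i * p i) \<le> (\<Sum>i=k..<n. d k * p i)"
    by (intro sum_mono mult_right_mono anti) (auto simp: p0)
  have "0 \<le> d k * (real k - (\<Sum>i<n. p i))"
    using nonneg[OF kn] psum by simp
  also have "\<dots> = (\<Sum>i<k. d k * (1 - p i)) - (\<Sum>i=k..<n. d k * p i)"
    by (subst split) (simp add: sum_subtractf algebra_simps flip: sum_distrib_left)
  finally have "(\<Sum>i=k..<n. d k * p i) \<le> (\<Sum>i<k. d k * (1 - p i))" by simp
  with head tail have "(\<Sum>i=k..<n. d i * p i) \<le> (\<Sum>i<k. d i * (1 - p i))" by linarith
  moreover have "(\<Sum>i=k..<n. d i * (1 - p i)) = (\<Sum>i=k..<n. d i) - (\<Sum>i=k..<n. d i * p i)"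
    by (simp add: right_diff_distrib sum_subtractf)
  ultimately show ?thesis by (subst split) linarith
qed

text \<open>
  Every row of \<open>u v\<^sup>T\<close> lies in the span of the \<open>k\<close> columns of \<open>v\<close>. Row \<open>i\<close> of the diagonal matrix
  is \<open>b\<^sub>i e\<^sub>i\<close>, whose squared distance to this span is at least \<open>b\<^sub>i\<^sup>2 (1 - P\<^sub>i\<^sub>i)\<close> for the projection \<open>P\<close>,
  and the weights \<open>P\<^sub>i\<^sub>i\<close> lie in \<open>[0, 1]\<close> and sum to at most \<open>k\<close>.
\<close>

lemma Eckart_Young_diagonal:
  fixes u v :: "nat \<Rightarrow> nat \<Rightarrow> real" and b :: "nat \<Rightarrow> real"
  assumes anti: "\<And>i j. i \<le> j \<Longrightarrow> j < n \<Longrightarrow> b j \<le> b i"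
    and nonneg: "\<And>i. i < n \<Longrightarrow> 0 \<le> b i" and k: "k \<le> n"
  shows "(\<Sum>i=k..<n. (b i)\<^sup>2)
    \<le> (\<Sum>i<n. \<Sum>j<n. ((\<Sum>l<k. u i l * v j l) - (if i = j then b i else 0))\<^sup>2)"
proof -
  obtain P where sym: "\<And>i j. P i j = P j i"
    and idem: "\<And>i j. (\<Sum>m<n. P i m * P m j) = P i j"
    and fixP: "\<And>l i. l < k \<Longrightarrow> i < n \<Longrightarrow> (\<Sum>m<n. P i m * v m l) = v i l"
    and tr: "(\<Sum>i<n. P i i) \<le> real k"
    using exists_projection[OF finite_lessThan, of n k "\<lambda>l j. v j l"]
    unfolding Ball_def lessThan_iff by blast
  have rows: "(b i)\<^sup>2 * (1 - P i i)
      \<le> (\<Sum>j<n. ((\<Sum>l<k. u i l * v j l) - (if i = j then b i else 0))\<^sup>2)" if "i < n" for i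
  proof (rule dist_axis_ge_projection[OF finite_lessThan _ sym idem, where x = "\<lambda>j. \<Sum>l<k. u i l * v j l"])
    fix j assume j: "j \<in> {..<n}"
    have "(\<Sum>m<n. P j m * (\<Sum>l<k. u i l * v m l)) = (\<Sum>l<k. u i l * (\<Sum>m<n. P j m * v m l))"
      by (simp add: sum_distrib_left mult.left_commute) (rule sum.swap)
    then show "(\<Sum>m<n. P j m * (\<Sum>l<k. u i l * v m l)) = (\<Sum>l<k. u i l * v j l)"
      using fixP j by simp
  qed (use that in simp)
  have "(\<Sum>i=k..<n. (b i)\<^sup>2) \<le> (\<Sum>i<n. (b i)\<^sup>2 * (1 - P i i))"
  proof (rule tail_le_weighted_sum)
    show "(b j)\<^sup>2 \<le> (b i)\<^sup>2" if "i \<le> j" "j < n" for i j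
      using that anti nonneg by (intro power_mono) auto
    show "0 \<le> P i i" "P i i \<le> 1" if "i < n" for i
      using that projection_diagonal_bounds[where I = "{..<n}" and P = P and i = i, OF _ _ sym idem]
      by simp_all
  qed (use tr k in auto)
  also have "\<dots> \<le> (\<Sum>i<n. \<Sum>j<n. ((\<Sum>l<k. u i l * v j l) - (if i = j then b i else 0))\<^sup>2)"
    by (intro sum_mono rows) auto
  finally show ?thesis .
qed

text \<open>
  The left-hand side is the value of the right-hand side when the product is diagonal with entries
  \<open>b\<^sub>i\<close> for \<open>i < k\<close>, split evenly between the two factors. The proof compares the distances to the
  diagonal matrices \<open>a\<close> and \<open>b\<close>; their difference is linear in the product, and the quadratic penalty
  dominates it because \<open>2 u\<^sub>i \<bullet> v\<^sub>i \<le> \<parallel>u\<^sub>i\<parallel>\<^sup>2 + \<parallel>v\<^sub>i\<parallel>\<^sup>2\<close> and \<open>0 \<le> a\<^sub>i - b\<^sub>i \<le> \<tau>\<close>.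
\<close>

lemma penalized_diagonal_bound:
  fixes u v :: "nat \<Rightarrow> nat \<Rightarrow> real" and a :: "nat \<Rightarrow> real" and \<tau> :: real
  defines "b \<equiv> \<lambda>i. max 0 (a i - \<tau>)"
  assumes anti: "\<And>i j. i \<le> j \<Longrightarrow> j < n \<Longrightarrow> a j \<le> a i"
    and nonneg: "\<And>i. i < n \<Longrightarrow> 0 \<le> a i" and k: "k \<le> n" and \<tau>: "0 \<le> \<tau>"
  shows "(\<Sum>i<k. (b i - a i)\<^sup>2) + (\<Sum>i=k..<n. (a i)\<^sup>2) + 2 * \<tau> * (\<Sum>i<k. b i)
    \<le> (\<Sum>i<n. \<Sum>j<n. ((\<Sum>l<k. u i l * v j l) - (if i = j then a i else 0))\<^sup>2)
      + \<tau> * ((\<Sum>i<n. \<Sum>l<k. (u i l)\<^sup>2) + (\<Sum>i<n. \<Sum>l<k. (v i l)\<^sup>2))"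
proof -
  define X where "X i j = (\<Sum>l<k. u i l * v j l)" for i j
  define q where "q i = (\<Sum>l<k. (u i l)\<^sup>2) + (\<Sum>l<k. (v i l)\<^sup>2)" for i
  have split: "(\<Sum>i<n. f i) = (\<Sum>i<k. f i) + (\<Sum>i=k..<n. f i)" for f :: "nat \<Rightarrow> real"
    using sum.atLeastLessThan_concat[of 0 k n f] k by (simp add: atLeast0LessThan)
  have row: "(\<Sum>j<n. (X i j - (if i = j then b i else 0))\<^sup>2) + (a i)\<^sup>2 - (b i)\<^sup>2
     \<le> (\<Sum>j<n. (X i j - (if i = j then a i else 0))\<^sup>2) + \<tau> * q i" if i: "i < n" for i
  proof -
    have expand: "(\<Sum>j<n. (X i j - (if i = j then t else 0))\<^sup>2)
        = (\<Sum>j<n. (X i j)\<^sup>2) - 2 * t * X i i + t\<^sup>2" for t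
    proof -
      have "(\<Sum>j<n. (X i j - (if i = j then t else 0))\<^sup>2)
          = (\<Sum>j<n. (X i j)\<^sup>2 + (if i = j then t\<^sup>2 - 2 * t * X i i else 0))"
        by (rule sum.cong) (auto simp: power2_eq_square algebra_simps)
      then show ?thesis using i by (simp add: sum.distrib)
    qed
    have q0: "0 \<le> q i" by (simp add: q_def sum_nonneg)
    have "2 * X i i = (\<Sum>l<k. 2 * (u i l * v i l))" by (simp add: X_def sum_distrib_left)
    also have "\<dots> \<le> (\<Sum>l<k. (u i l)\<^sup>2 + (v i l)\<^sup>2)"
      by (rule sum_mono) (use sum_squares_bound in \<open>simp add: mult.assoc\<close>)
    finally have "2 * X i i \<le> q i" by (simp add: q_def sum.distrib)
    moreover have "0 \<le> a i - b i" "a i - b i \<le> \<tau>"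
      using nonneg[OF i] \<tau> by (auto simp: b_def)
    ultimately have "(a i - b i) * (2 * X i i) \<le> \<tau> * q i"
      using q0 by (meson mult_left_mono mult_right_mono order_trans)
    then show ?thesis unfolding expand by (simp add: algebra_simps)
  qed
  have "(\<Sum>i<k. (b i - a i)\<^sup>2) + 2 * \<tau> * (\<Sum>i<k. b i) = (\<Sum>i<k. (b i - a i)\<^sup>2 + 2 * \<tau> * b i)"
    by (simp add: sum.distrib sum_distrib_left)
  \<comment> \<open>Complementary slackness of the soft threshold: \<open>b\<^sub>i (b\<^sub>i - a\<^sub>i + \<tau>) = 0\<close>.\<close>
  also have "\<dots> = (\<Sum>i<k. (a i)\<^sup>2 - (b i)\<^sup>2)"
    by (rule sum.cong) (auto simp: b_def max_def power2_eq_square algebra_simps)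
  finally have lhs: "(\<Sum>i<k. (b i - a i)\<^sup>2) + (\<Sum>i=k..<n. (a i)\<^sup>2) + 2 * \<tau> * (\<Sum>i<k. b i)
      = (\<Sum>i=k..<n. (b i)\<^sup>2) + (\<Sum>i<n. (a i)\<^sup>2 - (b i)\<^sup>2)"
    by (subst split) (simp add: sum_subtractf)
  have low_rank: "(\<Sum>i=k..<n. (b i)\<^sup>2) \<le> (\<Sum>i<n. \<Sum>j<n. (X i j - (if i = j then b i else 0))\<^sup>2)"
    unfolding X_def
  proof (rule Eckart_Young_diagonal)
    show "b j \<le> b i" if "i \<le> j" "j < n" for i j
      using anti[OF that] by (simp add: b_def max_def)
  qed (auto simp: b_def k)
  have "(\<Sum>i<n. (\<Sum>j<n. (X i j - (if i = j then b i else 0))\<^sup>2) + ((a i)\<^sup>2 - (b i)\<^sup>2))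
      \<le> (\<Sum>i<n. (\<Sum>j<n. (X i j - (if i = j then a i else 0))\<^sup>2) + \<tau> * q i)"
    by (rule sum_mono) (use row in \<open>simp add: add_diff_eq\<close>)
  then have rows: "(\<Sum>i<n. \<Sum>j<n. (X i j - (if i = j then b i else 0))\<^sup>2) + (\<Sum>i<n. (a i)\<^sup>2 - (b i)\<^sup>2)
      \<le> (\<Sum>i<n. \<Sum>j<n. (X i j - (if i = j then a i else 0))\<^sup>2) + \<tau> * (\<Sum>i<n. q i)"
    by (simp only: sum.distrib sum_distrib_left)
  have q_sum: "(\<Sum>i<n. q i) = (\<Sum>i<n. \<Sum>l<k. (u i l)\<^sup>2) + (\<Sum>i<n. \<Sum>l<k. (v i l)\<^sup>2)"
    by (simp only: q_def sum.distrib)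
  show ?thesis
    unfolding X_def[symmetric] q_sum[symmetric] using lhs low_rank rows by linarith
qed

text \<open>
  Bounds on \<open>r\<^sup>2 + 2 \<tau> N\<close> for all weights \<open>\<tau>\<close> give a bound on \<open>r + \<rho> N\<close>: take \<open>\<tau>\<close> proportional to
  \<open>r\<close> and absorb the squares by \<open>2 r R \<le> r\<^sup>2 + R\<^sup>2\<close>.
\<close>

lemma le_of_penalized_bounds:
  fixes r N \<rho> m :: real and R S :: "real \<Rightarrow> real"
  assumes \<rho>: "\<rho> > 0" and r: "0 \<le> r"
    and pen: "\<And>\<tau>. 0 \<le> \<tau> \<Longrightarrow> (R \<tau>)\<^sup>2 + 2 * \<tau> * S \<tau> \<le> r\<^sup>2 + 2 * \<tau> * N"
    and m: "\<And>\<tau>. m \<le> R \<tau> + \<rho> * S \<tau>"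
  shows "m \<le> r + \<rho> * N"
proof (rule field_le_epsilon)
  fix e :: real assume e: "0 < e"
  \<comment> \<open>The slack \<open>e\<close> keeps the weight positive when \<open>r = 0\<close>, so that \<open>t\<close> can be cancelled.\<close>
  define t where "t = r + e"
  have t: "0 < t" "r \<le> t" using e r by (auto simp: t_def)
  define \<tau> where "\<tau> = \<rho> * t"
  have "2 * (t * R \<tau>) \<le> t\<^sup>2 + (R \<tau>)\<^sup>2"
    using sum_squares_bound[of t "R \<tau>"] by simp
  also have "(R \<tau>)\<^sup>2 \<le> t\<^sup>2 + 2 * \<tau> * N - 2 * \<tau> * S \<tau>"
    using pen[of \<tau>] power_mono[OF t(2) r, of 2] \<rho> t by (simp add: \<tau>_def)
  finally have "t * (R \<tau> + \<rho> * S \<tau>) \<le> t * (t + \<rho> * N)"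
    by (simp add: \<tau>_def power2_eq_square algebra_simps)
  then have "R \<tau> + \<rho> * S \<tau> \<le> t + \<rho> * N" using t by simp
  with m[of \<tau>] show "m \<le> r + \<rho> * N + e" by (simp add: t_def)
qed

section \<open>The Frobenius norm\<close>

lemma frobenius_norm_nonneg: "0 \<le> frobenius_norm M"
  by (simp add: frobenius_norm_def)

lemma frobenius_norm_sq:
  assumes "M \<in> carrier_mat n m"
  shows "(frobenius_norm M)\<^sup>2 = (\<Sum>i<n. \<Sum>j<m. (M $$ (i, j))\<^sup>2)"
  using assms
  by (simp add: frobenius_norm_def L2_set_def sum_nonneg case_prod_unfold sum.cartesian_product)

lemma frobenius_norm_eqI:
  assumes "(frobenius_norm M)\<^sup>2 = (frobenius_norm N)\<^sup>2"
  shows "frobenius_norm M = frobenius_norm N"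
  using assms frobenius_norm_nonneg power2_eq_iff_nonneg by blast

text \<open>
  The squared norm is the trace of \<open>M\<^sup>T M\<close>, and an orthogonal left factor cancels in this product.
\<close>

lemma frobenius_norm_sq_gram:
  assumes M: "M \<in> carrier_mat n m"
  shows "(frobenius_norm M)\<^sup>2 = (\<Sum>j<m. (M\<^sup>T * M) $$ (j, j))"
proof -
  have "(M\<^sup>T * M) $$ (j, j) = (\<Sum>i<n. (M $$ (i, j))\<^sup>2)" if "j < m" for j
    using M that by (simp add: scalar_prod_def power2_eq_square atLeast0LessThan)
  then show ?thesis
    unfolding frobenius_norm_sq[OF M] by (subst sum.swap) simp
qed

lemma frobenius_norm_transpose:
  assumes M: "M \<in> carrier_mat n m"
  shows "frobenius_norm M\<^sup>T = frobenius_norm M"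
proof (rule frobenius_norm_eqI)
  have T: "M\<^sup>T \<in> carrier_mat m n" using M by simp
  show "(frobenius_norm M\<^sup>T)\<^sup>2 = (frobenius_norm M)\<^sup>2"
    unfolding frobenius_norm_sq[OF M] frobenius_norm_sq[OF T]
    by (subst sum.swap) (use M in simp)
qed

lemma frobenius_norm_orthogonal_left:
  assumes Q: "orthogonal_matrix_of n Q" and M: "M \<in> carrier_mat n m"
  shows "frobenius_norm (Q * M) = frobenius_norm M"
proof (rule frobenius_norm_eqI)
  have Qc: "Q \<in> carrier_mat n n" "Q\<^sup>T \<in> carrier_mat n n" and QQ: "Q\<^sup>T * Q = 1\<^sub>m n"
    using Q by (auto simp: orthogonal_matrix_of_def)
  have QM: "Q * M \<in> carrier_mat n m" and MT: "M\<^sup>T \<in> carrier_mat m n" using Qc M by auto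
  have "(Q * M)\<^sup>T * (Q * M) = M\<^sup>T * Q\<^sup>T * (Q * M)"
    using Qc M by (simp add: transpose_mult)
  also have "\<dots> = M\<^sup>T * (Q\<^sup>T * (Q * M))"
    by (rule assoc_mult_mat[OF MT Qc(2) QM])
  also have "Q\<^sup>T * (Q * M) = Q\<^sup>T * Q * M"
    by (rule assoc_mult_mat[OF Qc(2) Qc(1) M, symmetric])
  finally have "(Q * M)\<^sup>T * (Q * M) = M\<^sup>T * M" using M QQ by simp
  then show "(frobenius_norm (Q * M))\<^sup>2 = (frobenius_norm M)\<^sup>2"
    by (simp add: frobenius_norm_sq_gram[OF QM] frobenius_norm_sq_gram[OF M])
qed

lemma frobenius_norm_orthogonal_conj:
  assumes Q: "orthogonal_matrix_of n Q" and R: "orthogonal_matrix_of m R"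
    and M: "M \<in> carrier_mat n m"
  shows "frobenius_norm (Q * M * R\<^sup>T) = frobenius_norm M"
proof -
  have c: "Q \<in> carrier_mat n n" "R \<in> carrier_mat m m"
    using Q R by (auto simp: orthogonal_matrix_of_def)
  have QM: "Q * M \<in> carrier_mat n m" using c M by simp
  have "frobenius_norm (Q * M * R\<^sup>T) = frobenius_norm ((Q * M * R\<^sup>T)\<^sup>T)"
    using c M by (intro frobenius_norm_transpose[of _ n m, symmetric]) simp
  also have "(Q * M * R\<^sup>T)\<^sup>T = R * (Q * M)\<^sup>T"
    using transpose_mult[OF QM, of "R\<^sup>T" m] c by simp
  also have "frobenius_norm \<dots> = frobenius_norm (Q * M)"
    using frobenius_norm_orthogonal_left[OF R, of "(Q * M)\<^sup>T" n] QM
    by (simp add: frobenius_norm_transpose[OF QM])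
  finally show ?thesis by (simp add: frobenius_norm_orthogonal_left[OF Q M])
qed

lemma frobenius_norm_residual_rotate:
  assumes Q: "orthogonal_matrix_of n Q" and R: "orthogonal_matrix_of m R"
    and S: "S \<in> carrier_mat n m" and U: "U \<in> carrier_mat n k" and V: "V \<in> carrier_mat m k"
  shows "frobenius_norm ((Q * U) * (R * V)\<^sup>T - Q * S * R\<^sup>T) = frobenius_norm (U * V\<^sup>T - S)"
proof -
  have c: "Q \<in> carrier_mat n n" "R \<in> carrier_mat m m" "R\<^sup>T \<in> carrier_mat m m" "V\<^sup>T \<in> carrier_mat k m"
    using Q R V by (auto simp: orthogonal_matrix_of_def)
  have UV: "U * V\<^sup>T \<in> carrier_mat n m" and QU: "Q * U \<in> carrier_mat n k" using c U by auto
  have "(Q * U) * (R * V)\<^sup>T = Q * U * (V\<^sup>T * R\<^sup>T)"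
    using transpose_mult[OF c(2) V] by simp
  also have "\<dots> = Q * U * V\<^sup>T * R\<^sup>T"
    by (rule assoc_mult_mat[OF QU c(4) c(3), symmetric])
  also have "Q * U * V\<^sup>T = Q * (U * V\<^sup>T)"
    by (rule assoc_mult_mat[OF c(1) U c(4)])
  finally have "(Q * U) * (R * V)\<^sup>T - Q * S * R\<^sup>T = Q * (U * V\<^sup>T) * R\<^sup>T - Q * S * R\<^sup>T" by simp
  also have "\<dots> = (Q * (U * V\<^sup>T) - Q * S) * R\<^sup>T"
    by (rule minus_mult_distrib_mat[OF _ _ c(3), symmetric, of _ n]) (use c(1) UV S in simp_all)
  also have "Q * (U * V\<^sup>T) - Q * S = Q * (U * V\<^sup>T - S)"
    by (rule mult_minus_distrib_mat[OF c(1) UV S, symmetric])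
  finally show ?thesis
    using frobenius_norm_orthogonal_conj[OF Q R, of "U * V\<^sup>T - S"] S
    by (simp add: minus_carrier_mat)
qed

section \<open>Diagonal blocks\<close>

lemma
  assumes "v \<in> carrier_vec m" and "m \<le> n"
  shows diag_block_carrier: "Diag v @\<^sub>r 0\<^sub>m (n - m) m \<in> carrier_mat n m"
    and diag_block_index: "i < n \<Longrightarrow> j < m \<Longrightarrow>
      (Diag v @\<^sub>r 0\<^sub>m (n - m) m) $$ (i, j) = (if i = j then v $ i else 0)"
  using assms by (auto simp: append_rows_def Diag_def mat_diag_def)

lemma frobenius_norm_sq_diag_sqrt_block:
  assumes v: "v \<in> carrier_vec m" and m: "m \<le> n" and nonneg: "\<forall>i<m. 0 \<le> v $ i"
  shows "(frobenius_norm (Diag (map_vec sqrt v) @\<^sub>r 0\<^sub>m (n - m) m))\<^sup>2 = (\<Sum>i<m. v $ i)"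
proof -
  have v': "map_vec sqrt v \<in> carrier_vec m" using v by simp
  have "(frobenius_norm (Diag (map_vec sqrt v) @\<^sub>r 0\<^sub>m (n - m) m))\<^sup>2
      = (\<Sum>j<m. \<Sum>i<n. ((Diag (map_vec sqrt v) @\<^sub>r 0\<^sub>m (n - m) m) $$ (i, j))\<^sup>2)"
    unfolding frobenius_norm_sq[OF diag_block_carrier[OF v' m]] by (rule sum.swap)
  also have "\<dots> = (\<Sum>j<m. \<Sum>i<n. if i = j then v $ j else 0)"
    using v nonneg by (intro sum.cong refl) (auto simp: diag_block_index[OF v' m])
  finally show ?thesis using m by simp
qed

lemma frobenius_norm_sq_diag_residual:
  assumes v: "v \<in> carrier_vec k" and nonneg: "\<forall>i<k. 0 \<le> v $ i" and a: "a \<in> carrier_vec m"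
    and k: "k \<le> m" and m: "m \<le> n"
  shows "(frobenius_norm ((Diag (map_vec sqrt v) @\<^sub>r 0\<^sub>m (n - k) k)
            * (Diag (map_vec sqrt v) @\<^sub>r 0\<^sub>m (m - k) k)\<^sup>T - (Diag a @\<^sub>r 0\<^sub>m (n - m) m)))\<^sup>2
    = (\<Sum>i<k. (v $ i - a $ i)\<^sup>2) + (\<Sum>i=k..<m. (a $ i)\<^sup>2)"
proof -
  define D where "D p = Diag (map_vec sqrt v) @\<^sub>r 0\<^sub>m (p - k) k" for p
  define S where "S = Diag a @\<^sub>r 0\<^sub>m (n - m) m"
  have v': "map_vec sqrt v \<in> carrier_vec k" using v by simp
  have kn: "k \<le> n" using k m by simp
  have D: "D n \<in> carrier_mat n k" "D m \<in> carrier_mat m k"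
    unfolding D_def by (rule diag_block_carrier[OF v' kn]) (rule diag_block_carrier[OF v' k])
  have S: "S \<in> carrier_mat n m"
    unfolding S_def by (rule diag_block_carrier[OF a m])
  have Didx: "D p $$ (i, j) = (if i = j then sqrt (v $ i) else 0)" if "k \<le> p" "i < p" "j < k" for p i j
    unfolding D_def using that v by (simp add: diag_block_index[OF v' that])
  have entry: "((D n * (D m)\<^sup>T - S) $$ (i, j))\<^sup>2
      = (if i = j then ((if j < k then v $ j else 0) - a $ j)\<^sup>2 else 0)" if "i < n" "j < m" for i j
  proof -
    have "(D n * (D m)\<^sup>T) $$ (i, j) = (\<Sum>l<k. D n $$ (i, l) * D m $$ (j, l))"
      using D that by (simp add: scalar_prod_def atLeast0LessThan)
    also have "\<dots> = (\<Sum>l<k. if l = j then (if i = j then v $ j else 0) else 0)"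
      using nonneg that k kn by (intro sum.cong refl) (auto simp: Didx)
    also have "\<dots> = (if i = j then (if j < k then v $ j else 0) else 0)" by simp
    finally show ?thesis
      using that S D by (simp add: S_def diag_block_index[OF a m])
  qed
  have c: "D n * (D m)\<^sup>T - S \<in> carrier_mat n m" using S by (simp add: minus_carrier_mat)
  have "(frobenius_norm (D n * (D m)\<^sup>T - S))\<^sup>2
      = (\<Sum>j<m. \<Sum>i<n. if i = j then ((if j < k then v $ j else 0) - a $ j)\<^sup>2 else 0)"
    unfolding frobenius_norm_sq[OF c] by (subst sum.swap) (intro sum.cong refl, simp add: entry)
  also have "\<dots> = (\<Sum>j<m. ((if j < k then v $ j else 0) - a $ j)\<^sup>2)"
    using m by (intro sum.cong refl) simp
  also have "\<dots> = (\<Sum>j<k. ((if j < k then v $ j else 0) - a $ j)\<^sup>2)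
      + (\<Sum>j=k..<m. ((if j < k then v $ j else 0) - a $ j)\<^sup>2)"
    using sum.atLeastLessThan_concat[of 0 k m "\<lambda>j. ((if j < k then v $ j else 0) - a $ j)\<^sup>2"] k
    by (simp add: atLeast0LessThan)
  also have "\<dots> = (\<Sum>i<k. (v $ i - a $ i)\<^sup>2) + (\<Sum>i=k..<m. (a $ i)\<^sup>2)"
    by (intro arg_cong2[of _ _ _ _ "(+)"] sum.cong refl) auto
  finally show ?thesis by (simp add: D_def S_def)
qed

lemma vec_norm2_sq:
  "(vec_norm2 v)\<^sup>2 = (\<Sum>i<dim_vec v. (v $ i)\<^sup>2)"
  by (simp add: vec_norm2_def L2_set_def sum_nonneg)

theorem theorem5:
  fixes n1 n2 k :: nat and \<rho> c :: real
    and A H W \<Sigma> :: "real mat" and a w s :: "real vec"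
  assumes "n2 \<le> n1" and "1 \<le> k" and "k \<le> n2" and "\<rho> > 0"
    and "A \<in> carrier_mat n1 n2"
    and "orthogonal_matrix_of n1 H" and "orthogonal_matrix_of n2 W"
    and "a \<in> carrier_vec n2"
    and "\<forall>i j. i \<le> j \<and> j < n2 \<longrightarrow> a $ j \<le> a $ i"
    and "\<forall>i<n2. 0 \<le> a $ i"
    and "\<Sigma> = Diag a @\<^sub>r 0\<^sub>m (n1 - n2) n2"
    and "A = H * \<Sigma> * W\<^sup>T"
    and "w = vec k (\<lambda>i. a $ i)"
    and "c = sqrt (\<Sum>i = k..<n2. (a $ i)\<^sup>2)"
    and "is_arg_min
           (\<lambda>s. sqrt ((vec_norm2 (s - w))\<^sup>2 + c\<^sup>2) + \<rho> * (s \<bullet> vec k (\<lambda>_. 1)))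
           (\<lambda>s. s \<in> carrier_vec k \<and> (\<forall>i<k. 0 \<le> s $ i))
           s"
  shows "is_arg_min
           (\<lambda>(U, V). frobenius_norm (U * V\<^sup>T - A)
                     + \<rho> / 2 * ((frobenius_norm U)\<^sup>2 + (frobenius_norm V)\<^sup>2))
           (\<lambda>(U, V). U \<in> carrier_mat n1 k \<and> V \<in> carrier_mat n2 k)
           (H * (Diag (map_vec sqrt s) @\<^sub>r 0\<^sub>m (n1 - k) k),
            W * (Diag (map_vec sqrt s) @\<^sub>r 0\<^sub>m (n2 - k) k))"
proof -
  note nn = assms(1) and kn = assms(3) and \<rho> = assms(4) and H = assms(6) and W = assms(7)
    and a = assms(8) and anti = assms(9) and nonneg = assms(10) and \<Sigma>_eq = assms(11) and A = assms(12)
    and opt = assms(15)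
  have kn1: "k \<le> n1" using kn nn by simp
  \<comment> \<open>The vector objective on coordinate functions, so that soft thresholds can be inserted
    without building vectors.\<close>
  define f where "f s = sqrt ((\<Sum>i<k. (s i - a $ i)\<^sup>2) + (\<Sum>i=k..<n2. (a $ i)\<^sup>2)) + \<rho> * (\<Sum>i<k. s i)"
    for s :: "nat \<Rightarrow> real"
  have f: "sqrt ((vec_norm2 (y - w))\<^sup>2 + c\<^sup>2) + \<rho> * (y \<bullet> vec k (\<lambda>_. 1)) = f (($) y)"
    if "y \<in> carrier_vec k" for y
    using that assms(13,14)
    by (simp add: f_def vec_norm2_sq scalar_prod_def atLeast0LessThan sum_nonneg)
  have s: "s \<in> carrier_vec k" and s0: "\<forall>i<k. 0 \<le> s $ i"
    using opt by (auto simp: is_arg_min_def)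
  have f_min: "f (($) s) \<le> f y" if y: "\<And>i. i < k \<Longrightarrow> 0 \<le> y i" for y
  proof -
    have "f (($) s) \<le> f (($) (vec k y))"
    proof (rule ccontr)
      assume "\<not> f (($) s) \<le> f (($) (vec k y))"
      then have less: "f (($) (vec k y)) < f (($) s)" by simp
      have "vec k y \<in> carrier_vec k \<and> (\<forall>i<k. 0 \<le> vec k y $ i)" using y by simp
      then show False
        using opt less unfolding is_arg_min_def f[OF s, symmetric] f[OF vec_carrier, symmetric]
        by blast
    qed
    also have "f (($) (vec k y)) = f y" by (simp add: f_def)
    finally show ?thesis .
  qed
  define F where "F U V = frobenius_norm (U * V\<^sup>T - A)
      + \<rho> / 2 * ((frobenius_norm U)\<^sup>2 + (frobenius_norm V)\<^sup>2)" for U V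
  have \<Sigma>: "\<Sigma> \<in> carrier_mat n1 n2"
    unfolding \<Sigma>_eq by (rule diag_block_carrier[OF a nn])
  have Hc: "H \<in> carrier_mat n1 n1" "H\<^sup>T \<in> carrier_mat n1 n1" "H * H\<^sup>T = 1\<^sub>m n1"
    and Wc: "W \<in> carrier_mat n2 n2" "W\<^sup>T \<in> carrier_mat n2 n2" "W * W\<^sup>T = 1\<^sub>m n2"
    using H W by (auto simp: orthogonal_matrix_of_def)
  have rotate: "F (H * U) (W * V) = frobenius_norm (U * V\<^sup>T - \<Sigma>)
      + \<rho> / 2 * ((frobenius_norm U)\<^sup>2 + (frobenius_norm V)\<^sup>2)"
    if "U \<in> carrier_mat n1 k" "V \<in> carrier_mat n2 k" for U V
    unfolding F_def A frobenius_norm_residual_rotate[OF H W \<Sigma> that]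
    by (simp add: frobenius_norm_orthogonal_left[OF H that(1)] frobenius_norm_orthogonal_left[OF W that(2)])
  have diag_bound: "f (($) s) \<le> frobenius_norm (U * V\<^sup>T - \<Sigma>)
      + \<rho> * (((frobenius_norm U)\<^sup>2 + (frobenius_norm V)\<^sup>2) / 2)"
    if U: "U \<in> carrier_mat n1 k" and V: "V \<in> carrier_mat n2 k" for U V
  proof (rule le_of_penalized_bounds[OF \<rho> frobenius_norm_nonneg])
    define b where "b \<tau> i = max 0 (a $ i - \<tau>)" for \<tau> i
    define R where "R \<tau> = sqrt ((\<Sum>i<k. (b \<tau> i - a $ i)\<^sup>2) + (\<Sum>i=k..<n2. (a $ i)\<^sup>2))" for \<tau>
    show "f (($) s) \<le> R \<tau> + \<rho> * (\<Sum>i<k. b \<tau> i)" for \<tau>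
      using f_min[of "b \<tau>"] by (simp add: f_def R_def b_def)
    fix \<tau> :: real assume \<tau>: "0 \<le> \<tau>"
    have c: "U * V\<^sup>T - \<Sigma> \<in> carrier_mat n1 n2" using \<Sigma> by (simp add: minus_carrier_mat)
    have entry: "(U * V\<^sup>T - \<Sigma>) $$ (i, j)
        = (\<Sum>l<k. U $$ (i, l) * V $$ (j, l)) - (if i = j then a $ i else 0)"
      if "i < n1" "j < n2" for i j
      using U V \<Sigma> that
      by (simp add: scalar_prod_def atLeast0LessThan) (simp add: \<Sigma>_eq diag_block_index[OF a nn])
    have "(R \<tau>)\<^sup>2 + 2 * \<tau> * (\<Sum>i<k. b \<tau> i)
        = (\<Sum>i<k. (b \<tau> i - a $ i)\<^sup>2) + (\<Sum>i=k..<n2. (a $ i)\<^sup>2) + 2 * \<tau> * (\<Sum>i<k. b \<tau> i)"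
      by (simp add: R_def sum_nonneg)
    also have "\<dots> \<le> (\<Sum>i<n2. \<Sum>j<n2.
          ((\<Sum>l<k. U $$ (i, l) * V $$ (j, l)) - (if i = j then a $ i else 0))\<^sup>2)
        + \<tau> * ((\<Sum>i<n2. \<Sum>l<k. (U $$ (i, l))\<^sup>2) + (\<Sum>i<n2. \<Sum>l<k. (V $$ (i, l))\<^sup>2))"
      unfolding b_def
      using penalized_diagonal_bound[of n2 "($) a" k \<tau> "\<lambda>i l. U $$ (i, l)" "\<lambda>i l. V $$ (i, l)"]
        anti nonneg kn \<tau> by blast
    \<comment> \<open>The rows of \<open>U\<close> with index at least \<open>n2\<close> meet only zero rows of \<open>\<Sigma>\<close>, so they can only
      increase the objective.\<close>
    also have "\<dots> \<le> (\<Sum>i<n1. \<Sum>j<n2. ((U * V\<^sup>T - \<Sigma>) $$ (i, j))\<^sup>2)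
        + \<tau> * ((\<Sum>i<n1. \<Sum>l<k. (U $$ (i, l))\<^sup>2) + (\<Sum>i<n2. \<Sum>l<k. (V $$ (i, l))\<^sup>2))"
    proof (intro add_mono mult_left_mono \<tau> order_refl)
      have "(\<Sum>i<n2. \<Sum>j<n2. ((\<Sum>l<k. U $$ (i, l) * V $$ (j, l)) - (if i = j then a $ i else 0))\<^sup>2)
          = (\<Sum>i<n2. \<Sum>j<n2. ((U * V\<^sup>T - \<Sigma>) $$ (i, j))\<^sup>2)"
        using nn by (intro sum.cong refl) (simp add: entry del: index_minus_mat)
      also have "\<dots> \<le> (\<Sum>i<n1. \<Sum>j<n2. ((U * V\<^sup>T - \<Sigma>) $$ (i, j))\<^sup>2)"
        using nn by (intro sum_mono2 sum_nonneg) auto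
      finally show "(\<Sum>i<n2. \<Sum>j<n2.
          ((\<Sum>l<k. U $$ (i, l) * V $$ (j, l)) - (if i = j then a $ i else 0))\<^sup>2) \<le> \<dots>" .
      show "(\<Sum>i<n2. \<Sum>l<k. (U $$ (i, l))\<^sup>2) \<le> (\<Sum>i<n1. \<Sum>l<k. (U $$ (i, l))\<^sup>2)"
        using nn by (intro sum_mono2 sum_nonneg) auto
    qed
    finally show "(R \<tau>)\<^sup>2 + 2 * \<tau> * (\<Sum>i<k. b \<tau> i) \<le> (frobenius_norm (U * V\<^sup>T - \<Sigma>))\<^sup>2
        + 2 * \<tau> * (((frobenius_norm U)\<^sup>2 + (frobenius_norm V)\<^sup>2) / 2)"
      by (simp add: frobenius_norm_sq[OF c] frobenius_norm_sq[OF U] frobenius_norm_sq[OF V])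
  qed
  have lower: "f (($) s) \<le> F U V"
    if U: "U \<in> carrier_mat n1 k" and V: "V \<in> carrier_mat n2 k" for U V
  proof -
    have "H * (H\<^sup>T * U) = U" "W * (W\<^sup>T * V) = V"
      using assoc_mult_mat[OF Hc(1,2) U] assoc_mult_mat[OF Wc(1,2) V] Hc(3) Wc(3) U V by auto
    moreover have "H\<^sup>T * U \<in> carrier_mat n1 k" "W\<^sup>T * V \<in> carrier_mat n2 k"
      using Hc(2) Wc(2) U V by auto
    ultimately show ?thesis
      using rotate[of "H\<^sup>T * U" "W\<^sup>T * V"] diag_bound[of "H\<^sup>T * U" "W\<^sup>T * V"] by simp
  qed
  define D where "D n = Diag (map_vec sqrt s) @\<^sub>r 0\<^sub>m (n - k) k" for n
  have Dc: "D n \<in> carrier_mat n k" if "k \<le> n" for n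
    unfolding D_def by (rule diag_block_carrier) (use s that in auto)
  have "frobenius_norm (D n1 * (D n2)\<^sup>T - \<Sigma>)
      = sqrt ((\<Sum>i<k. (s $ i - a $ i)\<^sup>2) + (\<Sum>i=k..<n2. (a $ i)\<^sup>2))"
    unfolding D_def \<Sigma>_eq frobenius_norm_sq_diag_residual[OF s s0 a kn nn, symmetric]
    by (simp add: frobenius_norm_nonneg)
  moreover have "(frobenius_norm (D n))\<^sup>2 = (\<Sum>i<k. s $ i)" if "k \<le> n" for n
    unfolding D_def by (rule frobenius_norm_sq_diag_sqrt_block[OF s that s0])
  ultimately have attained: "F (H * D n1) (W * D n2) = f (($) s)"
    using rotate[OF Dc[OF kn1] Dc[OF kn]] kn kn1 by (simp add: f_def)
  have "H * D n1 \<in> carrier_mat n1 k" "W * D n2 \<in> carrier_mat n2 k"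
    using Hc(1) Wc(1) Dc kn kn1 by auto
  moreover have "\<not> F U V < F (H * D n1) (W * D n2)"
    if "U \<in> carrier_mat n1 k" "V \<in> carrier_mat n2 k" for U V
    using lower[OF that] attained by simp
  ultimately show ?thesis
    unfolding F_def D_def by (auto simp: is_arg_min_def)
qed

end
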